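(* Suppose each loss $\phi_i$ is $(1/\gamma)$-smooth for some $\gamma>0$, i.e. $\phi_i$ is differentiable and $|\phi_i'(a)-\phi_i'(c)|\le \frac1\gamma|a-c|$ for all $a,c\in\mathbb{R}$. Suppose that the positive vector $v\in\mathbb{R}^n$ satisfies the ESO inequality (given in the context) for the sampling $\hat S$, and let $(\alpha^{(t)})_{t\ge 0}$ be the random iterates of mini-batch SDCA (given in the context) run with this $\hat S$ and $v$. Write $\|v\|_\infty=\max_i v_i$ and $b=\mathbb{E}[|\hat S|]$. Let $\epsilon_{\mathcal G}>0$ be a desired duality gap. (1) If the integer $T\ge 0$ satisfies $$T \ge \frac{\|v\|_\infty}{b}\left(\frac{1}{\lambda\gamma}+\frac{n}{\|v\|_\infty}\right)\log\left(\frac{\|v\|_\infty}{b}\left(\frac{1}{\lambda\gamma}+\frac{n}{\|v\|_\infty}\right)\frac{1}{\epsilon_{\mathcal G}}\right),$$ then $\mathbb{E}[\mathcal{P}(w_{\alpha^{(T)}})-\mathcal{D}(\alpha^{(T)})]\le\epsilon_{\mathcal G}$. (2) If the integers $T>T_0\ge 0$ satisfy $$T_0 \ge \frac{\|v\|_\infty}{b}\left(\frac{1}{\lambda\gamma}+\frac{n}{\|v\|_\infty}\right)\log\left(\frac{\|v\|_\infty}{b}\left(\frac{1}{\lambda\gamma}+\frac{n}{\|v\|_\infty}\right)\frac{1}{(T-T_0)\epsilon_{\mathcal G}}\right),$$ then $\mathbb{E}[\mathcal{P}(\bar w)-\mathcal{D}(\bar\alpha)]\le\epsilon_{\mathcal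 G}$, where $\bar\alpha=\frac{1}{T-T_0}\sum_{t=T_0}^{T-1}\alpha^{(t)}$ and $\bar w=w_{\bar\alpha}$. (3) If $\rho\in(0,1)$ and the integer $\tilde T\ge 0$ satisfies $$\tilde T\ge \frac{\|v\|_\infty+\lambda n\gamma}{b\lambda\gamma}\log\left(\frac{\|v\|_\infty+\lambda n\gamma}{b\lambda\gamma}\cdot\frac{1}{\epsilon_{\mathcal G}\,\rho}\right),$$ then $\mathbb{P}\left(\mathcal{P}(w_{\alpha^{(\tilde T)}})-\mathcal{D}(\alpha^{(\tilde T)})\le\epsilon_{\mathcal G}\right)\ge 1-\rho$.
   Context: Setting. Let $x_1,\dots,x_n\in\mathbb{R}^d$ be training examples, $X=[x_1,\dots,x_n]^T\in\mathbb{R}^{n\times d}$, and $\lambda>0$. Let $\phi_1,\dots,\phi_n:\mathbb{R}\to\mathbb{R}$ be convex loss functions that are non-negative and satisfy $\phi_i(0)\le 1$ for all $i$. The primal objective is $\mathcal{P}(w)=\frac1n\sum_{i=1}^n\phi_i(w^Tx_i)+\frac{\lambda}{2}\|w\|^2$ for $w\in\mathbb{R}^d$, to be minimized. The dual objective is $\mathcal{D}(\alpha)=-\frac1n\sum_{i=1}^n\phi_i^*(-\alpha_i)-\frac{\lambda}{2}\left\|\frac{1}{\lambda n}X^T\alpha\right\|^2$ for $\alpha\in\mathbb{R}^n$, to be maximized, where $\phi_i^*(u)=\sup_{z}(zu-\phi_i(z))\in\mathbb{R}\cup\{+\infty\}$ is the convex conjugate. For $\alpha\in\mathbb{R}^n$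 set $w_\alpha=\frac{1}{\lambda n}X^T\alpha$. Sampling. $\hat S$ is a random subset of $\{1,\dots,n\}$ with uniform marginals, i.e. $\mathbb{P}(i\in\hat S)$ is the same for all $i$; $b=\mathbb{E}[|\hat S|]>0$, so $\mathbb{P}(i\in\hat S)=b/n$. For $t\in\mathbb{R}^n$ and $S\subseteq\{1,\dots,n\}$, $t_{[S]}\in\mathbb{R}^n$ has $i$-th coordinate $t_i$ if $i\in S$ and $0$ otherwise. For a positive vector $v\in\mathbb{R}^n$, $\|t\|_v^2=\sum_{i=1}^n v_it_i^2$. ESO inequality (expected separable overapproximation) for $v$ and $\hat S$: for all $\alpha,t\in\mathbb{R}^n$, $$\mathbb{E}\left[\left\|\tfrac{1}{\lambda n}X^T(\alpha+t_{[\hat S]})\right\|^2\right]\le\|w_\alpha\|^2+\frac{b}{n}\left(\left\|\tfrac{1}{\lambda n}t\right\|_v^2+\frac{2}{\lambda n}t^TXw_\alpha\right).$$ Mini-batch SDCA (with inputs $\hat S$, $v$). Set $\alpha^{(0)}=0\in\mathbb{R}^n$. For $t=0,1,2,\dots$: draw $S_t$ from the distribution of $\hat S$, independently of the past; for each $i\in S_t$ set $\alpha_i^{(t+1)}=\alpha_i^{(t)}+\Delta\alpha_i^{(t)}$, where $$\Delta\alpha_i^{(t)}=\arg\max_{\delta\in\mathbb{R}}\left\{-\phi_i^*(-\alpha_i^{(t)}-\delta)-\frac{1}{2\lambda n}v_i\delta^2-w_{\alpha^{(t)}}^Tx_i\,\delta\right\};$$ for $i\notin S_t$ set $\alpha_i^{(t+1)}=\alpha_i^{(t)}$.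 *)

theory Defs
  imports "HOL-Probability.Probability"
begin

text \<open>
  The training examples are the rows of \<^term>\<open>X :: real^'d^'n\<close>, so that example \<^term>\<open>i\<close> is
  \<^term>\<open>row i X\<close>, the number of examples is \<^term>\<open>CARD('n)\<close> and the dimension is \<^term>\<open>CARD('d)\<close>.
\<close>

definition conjugate :: "(real \<Rightarrow> real) \<Rightarrow> real \<Rightarrow> ereal" where
  "conjugate f u = (SUP z. ereal (z * u - f z))"

definition smooth_loss :: "real \<Rightarrow> (real \<Rightarrow> real) \<Rightarrow> bool" where
  "smooth_loss L f \<longleftrightarrow>
     (\<forall>a. f differentiable (at a)) \<and> (\<forall>a c. \<bar>deriv f a - deriv f c\<bar> \<le> L * \<bar>a - c\<bar>)"

definition primal_of_dual :: "real \<Rightarrow> real^'d^'n \<Rightarrow> real^'n \<Rightarrow> real^'d" where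
  "primal_of_dual lam X \<alpha> = (1 / (lam * real CARD('n))) *\<^sub>R (transpose X *v \<alpha>)"

definition primal :: "real \<Rightarrow> real^'d^'n \<Rightarrow> ('n \<Rightarrow> real \<Rightarrow> real) \<Rightarrow> real^'d \<Rightarrow> real" where
  "primal lam X \<phi> w =
     (1 / real CARD('n)) * (\<Sum>i\<in>UNIV. \<phi> i (w \<bullet> row i X)) + lam / 2 * (norm w)\<^sup>2"

text \<open>
  A conjugate of a real-valued function is never \<open>-\<infinity>\<close>, so the extended-real sum and differences
  below never meet an undetermined \<open>\<infinity> - \<infinity>\<close>.
\<close>

definition dual :: "real \<Rightarrow> real^'d^'n \<Rightarrow> ('n \<Rightarrow> real \<Rightarrow> real) \<Rightarrow> real^'n \<Rightarrow> ereal" where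
  "dual lam X \<phi> \<alpha> =
     - (ereal (1 / real CARD('n)) * (\<Sum>i\<in>UNIV. conjugate (\<phi> i) (- (\<alpha> $ i))))
     - ereal (lam / 2 * (norm (primal_of_dual lam X \<alpha>))\<^sup>2)"

definition duality_gap :: "real \<Rightarrow> real^'d^'n \<Rightarrow> ('n \<Rightarrow> real \<Rightarrow> real) \<Rightarrow> real^'n \<Rightarrow> ereal" where
  "duality_gap lam X \<phi> \<alpha> = ereal (primal lam X \<phi> (primal_of_dual lam X \<alpha>)) - dual lam X \<phi> \<alpha>"

text \<open>A sampling is given by its distribution, a \<^typ>\<open>'n set pmf\<close>.\<close>

definition uniform_sampling :: "'n set pmf \<Rightarrow> bool" where
  "uniform_sampling p \<longleftrightarrow>
     (\<forall>i j. measure_pmf.prob p {S. i \<in> S} = measure_pmf.prob p {S. j \<in> S})"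

definition mean_batch_size :: "'n set pmf \<Rightarrow> real" where
  "mean_batch_size p = measure_pmf.expectation p (\<lambda>S. real (card S))"

definition restrict_vec :: "real^'n \<Rightarrow> 'n set \<Rightarrow> real^'n" where
  "restrict_vec t S = (\<chi> i. if i \<in> S then t $ i else 0)"

definition weighted_norm_sq :: "real^'n \<Rightarrow> real^'n \<Rightarrow> real" where
  "weighted_norm_sq v t = (\<Sum>i\<in>UNIV. v $ i * (t $ i)\<^sup>2)"

definition vec_max :: "real^'n \<Rightarrow> real" where
  "vec_max v = Max (range (\<lambda>i. v $ i))"

definition ESO :: "real \<Rightarrow> real^'d^'n \<Rightarrow> 'n set pmf \<Rightarrow> real^'n \<Rightarrow> bool" where
  "ESO lam X p v \<longleftrightarrow>
     (\<forall>\<alpha> t. measure_pmf.expectation p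
               (\<lambda>S. (norm ((1 / (lam * real CARD('n))) *\<^sub>R
                        (transpose X *v (\<alpha> + restrict_vec t S))))\<^sup>2)
        \<le> (norm (primal_of_dual lam X \<alpha>))\<^sup>2
          + mean_batch_size p / real CARD('n)
            * (weighted_norm_sq v ((1 / (lam * real CARD('n))) *\<^sub>R t)
               + 2 / (lam * real CARD('n)) * (t \<bullet> (X *v primal_of_dual lam X \<alpha>))))"

definition sdca_increment ::
    "real \<Rightarrow> real^'d^'n \<Rightarrow> ('n \<Rightarrow> real \<Rightarrow> real) \<Rightarrow> real^'n \<Rightarrow> real^'n \<Rightarrow> 'n \<Rightarrow> real" where
  "sdca_increment lam X \<phi> v \<alpha> i =
     (ARG_MAX (\<lambda>\<delta>. - conjugate (\<phi> i) (- (\<alpha> $ i) - \<delta>)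
                   - ereal (1 / (2 * lam * real CARD('n)) * v $ i * \<delta>\<^sup>2)
                   - ereal ((primal_of_dual lam X \<alpha> \<bullet> row i X) * \<delta>)) \<delta>. True)"

text \<open>The iterates as a function of the sequence \<^term>\<open>B :: nat \<Rightarrow> 'n set\<close> of drawn mini-batches.\<close>

primrec sdca ::
    "real \<Rightarrow> real^'d^'n \<Rightarrow> ('n \<Rightarrow> real \<Rightarrow> real) \<Rightarrow> real^'n \<Rightarrow> (nat \<Rightarrow> 'n set) \<Rightarrow> nat \<Rightarrow> real^'n" where
  "sdca lam X \<phi> v B 0 = 0"
| "sdca lam X \<phi> v B (Suc t) =
     (let \<alpha> = sdca lam X \<phi> v B t
      in \<chi> i. if i \<in> B t then \<alpha> $ i + sdca_increment lam X \<phi> v \<alpha> i else \<alpha> $ i)"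

definition sdca_average ::
    "real \<Rightarrow> real^'d^'n \<Rightarrow> ('n \<Rightarrow> real \<Rightarrow> real) \<Rightarrow> real^'n \<Rightarrow> (nat \<Rightarrow> 'n set) \<Rightarrow> nat \<Rightarrow> nat \<Rightarrow> real^'n"
  where
  "sdca_average lam X \<phi> v B T0 T =
     (1 / real (T - T0)) *\<^sub>R (\<Sum>t = T0..<T. sdca lam X \<phi> v B t)"

text \<open>
  Expectation of an extended-real random variable, as the expectation of its positive part minus
  that of its negative part (\<^const>\<open>e2ennreal\<close> sends negative values to 0). Since
  \<open>\<infinity> - \<infinity> = \<infinity>\<close> in \<^typ>\<open>ereal\<close>, a finite upper bound on it implies that the expectation is
  well defined.
\<close>

definition ereal_expectation :: "'w measure \<Rightarrow> ('w \<Rightarrow> ereal) \<Rightarrow> ereal" where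
  "ereal_expectation M f =
     enn2ereal (\<integral>\<^sup>+ \<omega>. e2ennreal (f \<omega>) \<partial>M) - enn2ereal (\<integral>\<^sup>+ \<omega>. e2ennreal (- f \<omega>) \<partial>M)"

end

theory Submission
  imports Defs
begin

text \<open>
  One step of SDCA increases the dual objective, in conditional expectation, by at least \<open>1 / K\<close>
  times the current duality gap, where \<open>K = (\<parallel>v\<parallel>\<^sub>\<infinity> + \<lambda> n \<gamma>) / (b \<lambda> \<gamma>)\<close>. To see this, the ESO inequality
  separates the expected increase over the coordinates, and each coordinate maximizer is compared
  with the move from \<open>\<alpha>\<^sub>i\<close> a fraction of the way towards \<open>- \<phi>\<^sub>i'(x\<^sub>i \<bullet> w)\<close>; the \<open>\<gamma>\<close>-strong convexity
  of the conjugates pays for the quadratic penalty.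

  Since the gap dominates the dual suboptimality, the latter contracts by \<open>1 - 1 / K\<close> in expectation
  and is at most \<open>exp (- t / K)\<close> after \<open>t\<close> steps. Conversely, the gaps from time \<open>T\<^sub>0\<close> on sum up to at
  most \<open>K\<close> times the suboptimality at \<open>T\<^sub>0\<close>, by telescoping; this gives the bounds for single
  iterates and, by convexity of the gap, for averages. Markov's inequality gives the last one.
\<close>

subsection \<open>Convex conjugates\<close>

lemma conjugate_ge: "ereal (z * u - f z) \<le> conjugate f u"
  unfolding conjugate_def by (rule SUP_upper) simp

lemma conjugate_le_iff: "conjugate f u \<le> ereal c \<longleftrightarrow> (\<forall>z. z * u - f z \<le> c)"
  unfolding conjugate_def by (simp add: SUP_le_iff)

lemma conjugate_neq_MInf [simp]: "conjugate f u \<noteq> -\<infinity>"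
  using conjugate_ge[of 0 u f] by auto

lemma conjugate_neq_PInf_if_le: "conjugate f u \<le> ereal c \<Longrightarrow> conjugate f u \<noteq> \<infinity>"
  by auto

lemma real_of_conjugate: "conjugate f u \<noteq> \<infinity> \<Longrightarrow> ereal (real_of_ereal (conjugate f u)) = conjugate f u"
  by (cases "conjugate f u") auto

lemma fenchel_young: "conjugate f u \<noteq> \<infinity> \<Longrightarrow> z * u - f z \<le> real_of_ereal (conjugate f u)"
  using conjugate_ge[of z u f] by (cases "conjugate f u") auto

lemma conjugate_le_realD: "conjugate f u \<le> ereal c \<Longrightarrow> real_of_ereal (conjugate f u) \<le> c"
  by (cases "conjugate f u") auto

lemma convex_above_tangent:
  assumes "convex_on UNIV f" and "smooth_loss L f"
  shows "f x + deriv f x * (y - x) \<le> f y"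
proof -
  have "(f has_real_derivative deriv f x) (at x)"
    using assms(2) by (simp add: smooth_loss_def DERIV_deriv_iff_real_differentiable)
  then have "f y - f x \<ge> deriv f x * (y - x)"
    using assms(1) by (intro convex_on_imp_above_tangent[where A = UNIV]) auto
  then show ?thesis by simp
qed

text \<open>The equality case of Fenchel-Young: the tangent at \<open>z\<close> lies below
  \<open>f\<close>, so the supremum is attained at \<open>z\<close>. It makes the conjugate finite
  and explicit at slopes of \<open>f\<close>.\<close>

lemma conjugate_deriv:
  assumes "convex_on UNIV f" and "smooth_loss L f"
  shows "conjugate f (deriv f z) = ereal (z * deriv f z - f z)"
proof (rule antisym)
  show "conjugate f (deriv f z) \<le> ereal (z * deriv f z - f z)"
    unfolding conjugate_le_iff
    using convex_above_tangent[OF assms] by (auto simp: algebra_simps)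
qed (rule conjugate_ge)

text \<open>The Lipschitz bound makes the derivative of \<open>f\<close> minus the quadratic model
  nonnegative to the left of \<open>x\<close> and nonpositive to its right, so this difference is
  largest at \<open>x\<close>.\<close>

lemma smooth_below_quadratic:
  assumes "smooth_loss L f"
  shows "f y \<le> f x + deriv f x * (y - x) + L / 2 * (y - x)\<^sup>2"
proof -
  define h where "h t = f t - deriv f x * (t - x) - L / 2 * (t - x)\<^sup>2" for t
  have diff: "(f has_real_derivative deriv f t) (at t)" for t
    using assms by (simp add: smooth_loss_def DERIV_deriv_iff_real_differentiable)
  have h': "(h has_real_derivative deriv f t - deriv f x - L * (t - x)) (at t)" for t
    unfolding h_def by (rule derivative_eq_intros diff refl | simp)+
  have lip: "\<bar>deriv f t - deriv f x\<bar> \<le> L * \<bar>t - x\<bar>" for t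
    using assms by (simp add: smooth_loss_def)
  have "h y \<le> h x"
  proof (cases "x \<le> y")
    case True
    show ?thesis
    proof (rule DERIV_nonpos_imp_nonincreasing[OF True])
      fix t assume "x \<le> t"
      then have "deriv f t - deriv f x - L * (t - x) \<le> 0" using lip[of t] by simp
      then show "\<exists>d. (h has_real_derivative d) (at t) \<and> d \<le> 0" using h' by blast
    qed
  next
    case False
    show ?thesis
    proof (rule DERIV_nonneg_imp_nondecreasing[of y x])
      fix t assume "t \<le> x"
      then have "deriv f t - deriv f x - L * (t - x) \<ge> 0"
        using lip[of t] by (simp add: abs_if algebra_simps split: if_splits)
      then show "\<exists>d. (h has_real_derivative d) (at t) \<and> 0 \<le> d" using h' by blast
    qed (use False in simp)
  qed
  then show ?thesis by (simp add: h_def)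
qed

text \<open>
  The bound at a point \<open>z\<close> comes from testing the conjugates at \<open>a\<close> and \<open>u\<close> with two points whose
  convex combination is \<open>z\<close> and whose distance \<open>\<gamma> (u - a)\<close> is optimal.
\<close>

lemma conjugate_strongly_convex:
  assumes sm: "smooth_loss (1 / \<gamma>) f" and \<gamma>: "\<gamma> > 0" and s: "0 \<le> s" "s \<le> 1"
    and fin: "conjugate f a \<noteq> \<infinity>" "conjugate f u \<noteq> \<infinity>"
  shows "conjugate f ((1 - s) * a + s * u) \<le>
    ereal ((1 - s) * real_of_ereal (conjugate f a) + s * real_of_ereal (conjugate f u)
      - \<gamma> / 2 * s * (1 - s) * (u - a)\<^sup>2)"
  unfolding conjugate_le_iff
proof
  fix z
  define h where "h = \<gamma> * (u - a)"
  define y1 where "y1 = z + (1 - s) * h"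
  define y2 where "y2 = z - s * h"
  define Q where "Q = \<gamma> * (s * (1 - s) * (u - a)\<^sup>2)"
  define B1 where "B1 = f z + deriv f z * (y1 - z) + 1 / \<gamma> / 2 * (y1 - z)\<^sup>2"
  define B2 where "B2 = f z + deriv f z * (y2 - z) + 1 / \<gamma> / 2 * (y2 - z)\<^sup>2"
  have "s * (y1 * u) - s * f y1 \<le> s * real_of_ereal (conjugate f u)"
    unfolding right_diff_distrib[symmetric]
    using fenchel_young[OF fin(2)] s by (intro mult_left_mono)
  moreover have "(1 - s) * (y2 * a) - (1 - s) * f y2 \<le> (1 - s) * real_of_ereal (conjugate f a)"
    unfolding right_diff_distrib[symmetric, of "1 - s"]
    using fenchel_young[OF fin(1)] s by (intro mult_left_mono) auto
  moreover have "s * f y1 \<le> s * B1"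
    unfolding B1_def using smooth_below_quadratic[OF sm] s by (intro mult_left_mono)
  moreover have "(1 - s) * f y2 \<le> (1 - s) * B2"
    unfolding B2_def using smooth_below_quadratic[OF sm] s by (intro mult_left_mono) auto
  \<comment> \<open>Since \<open>z = s * y1 + (1 - s) * y2\<close>, the derivative terms cancel and
    the squares add up to \<open>Q / 2\<close>. The pairings with \<open>u\<close> and
    \<open>a\<close> below gain \<open>Q\<close>, which leaves a surplus of
    \<open>Q / 2\<close>.\<close>
  moreover have "s * B1 + (1 - s) * B2 = f z + Q / 2"
    unfolding y1_def y2_def h_def Q_def B1_def B2_def
    using \<gamma> by (simp add: field_simps power2_eq_square)
  moreover have "s * (y1 * u) + (1 - s) * (y2 * a) = z * ((1 - s) * a + s * u) + Q"
    unfolding y1_def y2_def h_def Q_def by (simp add: algebra_simps power2_eq_square)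
  moreover have "\<gamma> / 2 * s * (1 - s) * (u - a)\<^sup>2 = Q / 2"
    by (simp add: Q_def)
  ultimately show "z * ((1 - s) * a + s * u) - f z \<le>
      (1 - s) * real_of_ereal (conjugate f a) + s * real_of_ereal (conjugate f u)
      - \<gamma> / 2 * s * (1 - s) * (u - a)\<^sup>2"
    by linarith
qed

lemma le_conjugate_objective_iff:
  "ereal m \<le> - conjugate f u - ereal x - ereal y \<longleftrightarrow> (\<forall>z. z * u - f z \<le> - m - x - y)"
proof -
  have "ereal m \<le> - conjugate f u - ereal x - ereal y \<longleftrightarrow> conjugate f u \<le> ereal (- m - x - y)"
    by (cases "conjugate f u") auto
  then show ?thesis by (simp add: conjugate_le_iff)
qed

text \<open>This makes the \<open>ARG_MAX\<close> of the algorithm a true maximizer. A conjugate is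
  a supremum of affine functions, so superlevel sets of \<open>G\<close> are closed; the quadratic
  penalty makes them bounded. Nested nonempty compact sets share a point.\<close>

lemma proximal_maximizer_exists:
  fixes f :: "real \<Rightarrow> real" and k a c :: real
  assumes k: "k > 0"
  defines "G \<equiv> (\<lambda>\<delta>. - conjugate f (a - \<delta>) - ereal (k * \<delta>\<^sup>2) - ereal (c * \<delta>))"
  shows "\<exists>\<delta>. \<forall>\<delta>'. G \<delta>' \<le> G \<delta>"
proof (cases "(SUP \<delta>. G \<delta>) = -\<infinity>")
  case True
  then have "G \<delta> = -\<infinity>" for \<delta> using SUP_upper[of \<delta> UNIV G] by auto
  then show ?thesis by simp
next
  case False
  then have "-\<infinity> < (SUP \<delta>. G \<delta>)" by simp
  \<comment> \<open>The levels stay strictly below the supremum, so each superlevel set is nonempty,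
    and converge to it, so a common point is a maximizer.\<close>
  then obtain m where m: "incseq m" "\<And>i. ereal (m i) < (SUP \<delta>. G \<delta>)"
    "(\<lambda>i. ereal (m i)) \<longlonglongrightarrow> (SUP \<delta>. G \<delta>)"
    by (rule ereal_incseq_approx) auto
  define F where "F i = {\<delta>. ereal (m i) \<le> G \<delta>}" for i
  have F_eq: "F i = (\<Inter>z. {\<delta>. z * (a - \<delta>) - f z \<le> - m i - k * \<delta>\<^sup>2 - c * \<delta>})" for i
    unfolding F_def G_def le_conjugate_objective_iff by auto
  have "closed (F i)" for i
    unfolding F_eq by (intro closed_INT ballI closed_Collect_le continuous_intros)
  moreover have "bounded (F i)" for i
  proof -
    \<comment> \<open>Testing the conjugate with \<open>z = 0\<close> gives
      \<open>k * \<delta>\<^sup>2 + c * \<delta> \<le> f 0 - m i\<close>. Beyond the radius below,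
      the square outweighs the linear term and \<open>C\<close>; the summand 1 ensures
      \<open>C \<le> C * \<bar>\<delta>\<bar>\<close>.\<close>
    define C where "C = \<bar>f 0 - m i\<bar>"
    have "\<bar>\<delta>\<bar> \<le> 1 + (C + \<bar>c\<bar>) / k" if "\<delta> \<in> F i" for \<delta>
    proof (rule ccontr)
      assume "\<not> ?thesis"
      then have gt: "1 + (C + \<bar>c\<bar>) / k < \<bar>\<delta>\<bar>" by simp
      have C: "C \<ge> 0" by (simp add: C_def)
      have "0 \<le> (C + \<bar>c\<bar>) / k" using k C by simp
      then have 1: "1 < \<bar>\<delta>\<bar>" using gt by linarith
      have "k + (C + \<bar>c\<bar>) < k * \<bar>\<delta>\<bar>" using gt k by (simp add: field_simps)
      then have "(C + \<bar>c\<bar>) * \<bar>\<delta>\<bar> < (k * \<bar>\<delta>\<bar>) * \<bar>\<delta>\<bar>"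
        using 1 k by (intro mult_strict_right_mono) auto
      moreover have "C \<le> C * \<bar>\<delta>\<bar>" using 1 C by (simp add: mult_le_cancel_left1)
      moreover have "- (c * \<delta>) \<le> \<bar>c\<bar> * \<bar>\<delta>\<bar>" by (metis abs_ge_minus_self abs_mult)
      ultimately have "C < k * \<delta>\<^sup>2 + c * \<delta>"
        by (simp add: power2_eq_square algebra_simps)
      moreover have "k * \<delta>\<^sup>2 + c * \<delta> \<le> f 0 - m i"
        using that unfolding F_eq by (auto dest!: spec[of _ "0::real"])
      ultimately show False by (simp add: C_def)
    qed
    then show ?thesis unfolding bounded_real by blast
  qed
  ultimately have comp: "compact (F i)" for i by (simp add: compact_eq_bounded_closed)
  moreover have "F i \<noteq> {}" for i
    using m(2)[of i] unfolding F_def less_SUP_iff by (auto intro: less_imp_le)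
  moreover have "F j \<subseteq> F i" if "i \<le> j" for i j
    using incseqD[OF m(1) that] unfolding F_def
    by (auto intro: order_trans[of "ereal (m i)" "ereal (m j)"])
  ultimately have "\<Inter>(range F) \<noteq> {}" by (rule compact_nest)
  then obtain \<delta> where "\<And>i. ereal (m i) \<le> G \<delta>" unfolding F_def by auto
  then have "(SUP \<delta>. G \<delta>) \<le> G \<delta>" by (intro LIMSEQ_le_const2[OF m(3)]) auto
  then have "\<forall>\<delta>'. G \<delta>' \<le> G \<delta>" by (meson SUP_le_iff UNIV_I)
  then show ?thesis ..
qed

lemma arg_max_ge:
  fixes G :: "'a \<Rightarrow> 'b :: linorder"
  assumes "\<exists>x. \<forall>y. G y \<le> G x"
  shows "G y \<le> G (arg_max G (\<lambda>_. True))"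
proof -
  have "\<exists>x. is_arg_max G (\<lambda>_. True) x"
    using assms by (auto simp: is_arg_max_def not_less)
  then have "is_arg_max G (\<lambda>_. True) (arg_max G (\<lambda>_. True))"
    unfolding arg_max_def by (rule someI_ex)
  then show ?thesis by (auto simp: is_arg_max_def not_less)
qed

subsection \<open>The dual increase of one step\<close>

lemma vector_component_matrix: "(X *v w) $ i = w \<bullet> row i X" for X :: "real^'d^'n"
  by (simp add: matrix_vector_mul_component row_def inner_commute)

text \<open>Adjointness of \<open>X\<close> and its transpose turns the regularizer's cross term
  into an average over the examples, the form in which it meets the losses.\<close>

lemma inner_primal_of_dual:
  fixes X :: "real^'d^'n"
  assumes "lam \<noteq> 0"
  shows "lam * (w \<bullet> primal_of_dual lam X \<alpha>)
    = 1 / real CARD('n) * (\<Sum>i\<in>UNIV. \<alpha> $ i * (w \<bullet> row i X))"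
proof -
  have "w \<bullet> (transpose X *v \<alpha>) = \<alpha> \<bullet> (X *v w)"
    by (metis dot_lmul_matrix inner_commute transpose_matrix_vector)
  also have "\<dots> = (\<Sum>i\<in>UNIV. \<alpha> $ i * (w \<bullet> row i X))"
    by (simp add: inner_vec_def vector_component_matrix)
  finally show ?thesis using assms by (simp add: primal_of_dual_def)
qed

lemma primal_of_dual_linear: "linear (primal_of_dual lam X)"
  by (rule linearI)
    (simp_all add: primal_of_dual_def matrix_vector_right_distrib scaleR_add_right
      matrix_vector_mult_scaleR mult.commute)

lemma vec_max_ge: "v $ i \<le> vec_max v"
  unfolding vec_max_def by (rule Max_ge) auto

locale sdca_problem =
  fixes X :: "real^'d^'n" and lam \<gamma> :: real and \<phi> :: "'n \<Rightarrow> real \<Rightarrow> real"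
    and v :: "real^'n" and p :: "'n set pmf"
  assumes lam: "lam > 0"
    and loss_convex: "\<And>i. convex_on UNIV (\<phi> i)"
    and loss_nonneg: "\<And>i z. \<phi> i z \<ge> 0"
    and loss_zero: "\<And>i. \<phi> i 0 \<le> 1"
    and gamma: "\<gamma> > 0"
    and loss_smooth: "\<And>i. smooth_loss (1 / \<gamma>) (\<phi> i)"
    and sampling: "uniform_sampling p"
    and batch_pos: "mean_batch_size p > 0"
    and v_pos: "\<And>i. v $ i > 0"
    and eso: "ESO lam X p v"
begin

abbreviation w :: "real^'n \<Rightarrow> real^'d" where "w \<equiv> primal_of_dual lam X"

abbreviation prim :: "real^'d \<Rightarrow> real" where "prim \<equiv> primal lam X \<phi>"

text \<open>\<open>real_of_ereal\<close> sends infinity to 0, so this value is meaningful only on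
  the effective domain of the conjugate; \<open>dual_feasible\<close> keeps every coordinate
  there.\<close>

definition loss_conj :: "'n \<Rightarrow> real \<Rightarrow> real" where
  "loss_conj i u = real_of_ereal (conjugate (\<phi> i) u)"

definition dual_feasible :: "real^'n \<Rightarrow> bool" where
  "dual_feasible \<alpha> \<longleftrightarrow> (\<forall>i. conjugate (\<phi> i) (- (\<alpha> $ i)) \<noteq> \<infinity>)"

definition dual_value :: "real^'n \<Rightarrow> real" where
  "dual_value \<alpha> = - (1 / real CARD('n) * (\<Sum>i\<in>UNIV. loss_conj i (- (\<alpha> $ i)))) - lam / 2 * (norm (w \<alpha>))\<^sup>2"

definition gap :: "real^'n \<Rightarrow> real" where
  "gap \<alpha> = prim (w \<alpha>) - dual_value \<alpha>"

definition step :: "real^'n \<Rightarrow> 'n set \<Rightarrow> real^'n" where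
  "step \<alpha> s = (\<chi> i. if i \<in> s then \<alpha> $ i + sdca_increment lam X \<phi> v \<alpha> i else \<alpha> $ i)"

text \<open>The constant \<open>K\<close> of the overview: a time scale in steps, with contraction
  factor \<open>1 - 1 / rate\<close> per step.\<close>

definition rate :: real where
  "rate = (vec_max v + lam * real CARD('n) * \<gamma>) / (mean_batch_size p * lam * \<gamma>)"

lemma vec_max_pos: "vec_max v > 0"
  using v_pos vec_max_ge by (metis less_le_trans)

lemma ereal_loss_conj: "dual_feasible \<alpha> \<Longrightarrow> conjugate (\<phi> i) (- (\<alpha> $ i)) = ereal (loss_conj i (- (\<alpha> $ i)))"
  unfolding dual_feasible_def loss_conj_def by (simp add: real_of_conjugate)

lemma dual_eq: "dual_feasible \<alpha> \<Longrightarrow> dual lam X \<phi> \<alpha> = ereal (dual_value \<alpha>)"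
  unfolding dual_def dual_value_def by (simp add: ereal_loss_conj)

lemma duality_gap_eq: "dual_feasible \<alpha> \<Longrightarrow> duality_gap lam X \<phi> \<alpha> = ereal (gap \<alpha>)"
  by (simp add: duality_gap_def gap_def dual_eq)

section \<open>Weak duality and two forms of the gap\<close>

text \<open>Fenchel-Young for each example, averaged; the remaining inner product is bounded by
  completing the square.\<close>

lemma weak_duality:
  assumes "dual_feasible \<alpha>"
  shows "dual_value \<alpha> \<le> prim u"
proof -
  have "- loss_conj i (- (\<alpha> $ i)) \<le> \<phi> i (u \<bullet> row i X) + \<alpha> $ i * (u \<bullet> row i X)" for i
    using fenchel_young[of "\<phi> i" "- (\<alpha> $ i)" "u \<bullet> row i X"] assms
    by (simp add: dual_feasible_def loss_conj_def mult.commute)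
  then have "(\<Sum>i\<in>UNIV. - loss_conj i (- (\<alpha> $ i)))
      \<le> (\<Sum>i\<in>UNIV. \<phi> i (u \<bullet> row i X) + \<alpha> $ i * (u \<bullet> row i X))"
    by (intro sum_mono)
  then have "1 / real CARD('n) * (\<Sum>i\<in>UNIV. - loss_conj i (- (\<alpha> $ i)))
      \<le> 1 / real CARD('n) * (\<Sum>i\<in>UNIV. \<phi> i (u \<bullet> row i X) + \<alpha> $ i * (u \<bullet> row i X))"
    by (intro mult_left_mono) auto
  also have "\<dots> = 1 / real CARD('n) * (\<Sum>i\<in>UNIV. \<phi> i (u \<bullet> row i X)) + lam * (u \<bullet> w \<alpha>)"
    using inner_primal_of_dual[of lam u X \<alpha>] lam by (simp add: sum.distrib add_divide_distrib)
  also have "lam * (u \<bullet> w \<alpha>) \<le> lam / 2 * (norm u)\<^sup>2 + lam / 2 * (norm (w \<alpha>))\<^sup>2"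
  proof -
    have "0 \<le> lam / 2 * (norm (u - w \<alpha>))\<^sup>2" using lam by simp
    also have "\<dots> = lam / 2 * (norm u)\<^sup>2 + lam / 2 * (norm (w \<alpha>))\<^sup>2 - lam * (u \<bullet> w \<alpha>)"
      by (simp add: power2_norm_eq_inner inner_diff inner_commute algebra_simps)
    finally show ?thesis by simp
  qed
  finally show ?thesis
    unfolding dual_value_def primal_def by (simp add: sum_negf)
qed

lemma gap_nonneg: "dual_feasible \<alpha> \<Longrightarrow> 0 \<le> gap \<alpha>"
  using weak_duality by (simp add: gap_def)

text \<open>At \<open>w \<alpha>\<close> the two regularizers sum to
  \<open>lam * (norm (w \<alpha>))\<^sup>2\<close>, which splits over the examples. The gap becomes
  an average of Fenchel-Young residuals, comparable with the coordinate gains.\<close>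

lemma gap_eq_sum:
  "gap \<alpha> = 1 / real CARD('n) * (\<Sum>i\<in>UNIV. \<phi> i (w \<alpha> \<bullet> row i X) + loss_conj i (- (\<alpha> $ i)) + \<alpha> $ i * (w \<alpha> \<bullet> row i X))"
  using inner_primal_of_dual[of lam "w \<alpha>" X \<alpha>] lam
  by (simp add: gap_def primal_def dual_value_def sum.distrib add_divide_distrib power2_norm_eq_inner)

text \<open>In this form every term is visibly convex in \<open>\<alpha>\<close> on the feasible
  set, unlike the products in \<open>gap_eq_sum\<close>.\<close>

lemma gap_eq_norm:
  "gap \<alpha> = 1 / real CARD('n) * (\<Sum>i\<in>UNIV. \<phi> i (w \<alpha> \<bullet> row i X) + loss_conj i (- (\<alpha> $ i))) + lam * (norm (w \<alpha>))\<^sup>2"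
  by (simp add: gap_def primal_def dual_value_def sum.distrib add_divide_distrib)

text \<open>Nonnegative losses have a nonpositive conjugate at 0. With
  \<open>primal_zero_le\<close>, this bounds the initial suboptimality by 1.\<close>

lemma dual_feasible_zero: "dual_feasible 0" and dual_value_zero: "0 \<le> dual_value 0"
proof -
  have le: "conjugate (\<phi> i) 0 \<le> ereal 0" for i
    unfolding conjugate_le_iff using loss_nonneg by simp
  then show "dual_feasible 0"
    unfolding dual_feasible_def by (auto dest: conjugate_neq_PInf_if_le)
  have "(\<Sum>i\<in>UNIV. loss_conj i 0) \<le> 0"
    using conjugate_le_realD[OF le] by (intro sum_nonpos) (auto simp: loss_conj_def)
  moreover have "w 0 = 0" by (simp add: primal_of_dual_def)
  ultimately show "0 \<le> dual_value 0"
    unfolding dual_value_def by (simp add: divide_nonpos_pos)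
qed

lemma primal_zero_le: "prim 0 \<le> 1"
proof -
  have "(\<Sum>i\<in>(UNIV :: 'n set). \<phi> i 0) \<le> (\<Sum>i\<in>(UNIV :: 'n set). 1)"
    using loss_zero by (intro sum_mono)
  then show ?thesis unfolding primal_def by (simp add: divide_le_eq)
qed

lemma primal_nonneg: "0 \<le> prim u"
  unfolding primal_def using lam loss_nonneg
  by (auto intro!: add_nonneg_nonneg mult_nonneg_nonneg divide_nonneg_nonneg sum_nonneg)

text \<open>The maximal objective value is at least the value at \<open>\<delta> = 0\<close>, hence finite.\<close>

lemma increment_feasible:
  assumes "dual_feasible \<alpha>"
  defines "\<Delta> \<equiv> sdca_increment lam X \<phi> v \<alpha>"
  shows "conjugate (\<phi> i) (- (\<alpha> $ i) - \<Delta> i) \<noteq> \<infinity>"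
    and "conjugate (\<phi> i) (- (\<alpha> $ i) - \<delta>) \<noteq> \<infinity> \<Longrightarrow>
      - loss_conj i (- (\<alpha> $ i) - \<delta>) - v $ i * \<delta>\<^sup>2 / (2 * lam * real CARD('n)) - (w \<alpha> \<bullet> row i X) * \<delta>
      \<le> - loss_conj i (- (\<alpha> $ i) - \<Delta> i) - v $ i * (\<Delta> i)\<^sup>2 / (2 * lam * real CARD('n)) - (w \<alpha> \<bullet> row i X) * \<Delta> i"
proof -
  define G where "G = (\<lambda>\<delta>. - conjugate (\<phi> i) (- (\<alpha> $ i) - \<delta>)
    - ereal (1 / (2 * lam * real CARD('n)) * v $ i * \<delta>\<^sup>2) - ereal ((w \<alpha> \<bullet> row i X) * \<delta>))"
  have "\<exists>\<delta>. \<forall>\<delta>'. G \<delta>' \<le> G \<delta>"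
    unfolding G_def using lam v_pos by (intro proximal_maximizer_exists) simp
  then have max: "G \<delta> \<le> G (\<Delta> i)" for \<delta>
    unfolding \<Delta>_def sdca_increment_def G_def[symmetric] by (rule arg_max_ge)
  have "G 0 \<noteq> -\<infinity>"
    unfolding G_def using assms(1) by (cases "conjugate (\<phi> i) (- (\<alpha> $ i))") (auto simp: dual_feasible_def)
  then have "G (\<Delta> i) \<noteq> -\<infinity>" using max[of 0] by auto
  then show fin: "conjugate (\<phi> i) (- (\<alpha> $ i) - \<Delta> i) \<noteq> \<infinity>"
    unfolding G_def by auto
  have G: "G \<delta> = ereal (- loss_conj i (- (\<alpha> $ i) - \<delta>) - v $ i * \<delta>\<^sup>2 / (2 * lam * real CARD('n)) - (w \<alpha> \<bullet> row i X) * \<delta>)"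
    if "conjugate (\<phi> i) (- (\<alpha> $ i) - \<delta>) \<noteq> \<infinity>" for \<delta>
    using that unfolding G_def loss_conj_def
    by (cases "conjugate (\<phi> i) (- (\<alpha> $ i) - \<delta>)") auto
  show "- loss_conj i (- (\<alpha> $ i) - \<delta>) - v $ i * \<delta>\<^sup>2 / (2 * lam * real CARD('n)) - (w \<alpha> \<bullet> row i X) * \<delta>
      \<le> - loss_conj i (- (\<alpha> $ i) - \<Delta> i) - v $ i * (\<Delta> i)\<^sup>2 / (2 * lam * real CARD('n)) - (w \<alpha> \<bullet> row i X) * \<Delta> i"
    if "conjugate (\<phi> i) (- (\<alpha> $ i) - \<delta>) \<noteq> \<infinity>"
    using max[of \<delta>] unfolding G[OF that] G[OF fin] by simp
qed

lemma dual_feasible_step: "dual_feasible \<alpha> \<Longrightarrow> dual_feasible (step \<alpha> s)"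
  using increment_feasible(1)[of \<alpha>] by (auto simp: dual_feasible_def step_def)

text \<open>
  Test the maximality of the increment with \<open>\<delta> = \<sigma> (u - \<alpha>\<^sub>i)\<close>, where \<open>- u\<close> is the derivative of
  the loss at the current prediction. The choice of \<open>\<sigma>\<close> makes the strong convexity of the conjugate
  absorb the quadratic term.
\<close>

lemma increment_gain:
  assumes feas: "dual_feasible \<alpha>"
  defines "\<Delta> \<equiv> sdca_increment lam X \<phi> v \<alpha>"
    and "\<sigma> \<equiv> lam * real CARD('n) * \<gamma> / (vec_max v + lam * real CARD('n) * \<gamma>)"
    and "z \<equiv> \<lambda>i. w \<alpha> \<bullet> row i X"
  shows "\<sigma> * (\<phi> i (z i) + loss_conj i (- (\<alpha> $ i)) + \<alpha> $ i * z i)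
    \<le> loss_conj i (- (\<alpha> $ i)) - loss_conj i (- (\<alpha> $ i) - \<Delta> i)
      - v $ i * (\<Delta> i)\<^sup>2 / (2 * lam * real CARD('n)) - z i * \<Delta> i"
proof -
  define u where "u = - deriv (\<phi> i) (z i)"
  define \<delta> where "\<delta> = \<sigma> * (u - \<alpha> $ i)"
  have lng: "lam * real CARD('n) * \<gamma> > 0" using lam gamma by simp
  have \<sigma>: "0 \<le> \<sigma>" "\<sigma> \<le> 1"
    unfolding \<sigma>_def using lng vec_max_pos by auto
  have cu: "conjugate (\<phi> i) (- u) = ereal (- z i * u - \<phi> i (z i))"
    using conjugate_deriv[OF loss_convex loss_smooth, of i "z i"] by (simp add: u_def)
  have ca: "conjugate (\<phi> i) (- (\<alpha> $ i)) \<noteq> \<infinity>" using feas by (simp add: dual_feasible_def)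
  have arg: "(1 - \<sigma>) * (- (\<alpha> $ i)) + \<sigma> * (- u) = - (\<alpha> $ i) - \<delta>"
    by (simp add: \<delta>_def algebra_simps)
  have le: "conjugate (\<phi> i) (- (\<alpha> $ i) - \<delta>)
      \<le> ereal ((1 - \<sigma>) * loss_conj i (- (\<alpha> $ i)) + \<sigma> * (- z i * u - \<phi> i (z i))
          - \<gamma> / 2 * \<sigma> * (1 - \<sigma>) * (u - \<alpha> $ i)\<^sup>2)"
    using conjugate_strongly_convex[OF loss_smooth gamma \<sigma>, of i "- (\<alpha> $ i)" "- u"] ca cu
    unfolding arg by (simp add: loss_conj_def power2_commute)
  have fin: "conjugate (\<phi> i) (- (\<alpha> $ i) - \<delta>) \<noteq> \<infinity>"
    using conjugate_neq_PInf_if_le[OF le] .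
  note conj_le = conjugate_le_realD[OF le, folded loss_conj_def]
  have one_minus: "1 - \<sigma> = vec_max v / (vec_max v + lam * real CARD('n) * \<gamma>)"
    unfolding \<sigma>_def using lng vec_max_pos by (simp add: field_simps)
  have "\<sigma> * v $ i / (lam * real CARD('n)) = \<gamma> * v $ i / (vec_max v + lam * real CARD('n) * \<gamma>)"
    unfolding \<sigma>_def using lam by simp
  also have "\<dots> \<le> \<gamma> * vec_max v / (vec_max v + lam * real CARD('n) * \<gamma>)"
    using gamma lng vec_max_pos vec_max_ge[of v i] by (intro divide_right_mono mult_left_mono) auto
  also have "\<dots> = \<gamma> * (1 - \<sigma>)" by (simp add: one_minus)
  finally have "\<sigma> * v $ i / (lam * real CARD('n)) \<le> \<gamma> * (1 - \<sigma>)" .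
  then have "\<sigma> * v $ i / (lam * real CARD('n)) * (\<sigma> / 2 * (u - \<alpha> $ i)\<^sup>2) \<le> \<gamma> * (1 - \<sigma>) * (\<sigma> / 2 * (u - \<alpha> $ i)\<^sup>2)"
    using \<sigma> by (intro mult_right_mono) auto
  then have quad: "v $ i * \<delta>\<^sup>2 / (2 * lam * real CARD('n)) \<le> \<gamma> / 2 * \<sigma> * (1 - \<sigma>) * (u - \<alpha> $ i)\<^sup>2"
    by (simp add: \<delta>_def power_mult_distrib power2_eq_square mult_ac)
  \<comment> \<open>By the Fenchel-Young equality at \<open>- u\<close>, the scaled residual is
    exactly the gain of the trial move computed along the chord, without the strong convexity bonus
    and the penalty, which \<open>quad\<close> compares.\<close>
  have "\<sigma> * (\<phi> i (z i) + loss_conj i (- (\<alpha> $ i)) + \<alpha> $ i * z i)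
      = loss_conj i (- (\<alpha> $ i)) - ((1 - \<sigma>) * loss_conj i (- (\<alpha> $ i)) + \<sigma> * (- z i * u - \<phi> i (z i)))
        - z i * \<delta>"
    by (simp add: \<delta>_def algebra_simps)
  then show ?thesis
    using increment_feasible(2)[OF feas fin] conj_le quad unfolding \<Delta>_def z_def by linarith
qed

section \<open>Expected dual increase under uniform sampling\<close>

text \<open>The mean batch size is the sum of the marginals, and these are all equal.\<close>

lemma prob_mem: "measure_pmf.prob p {s. i \<in> s} = mean_batch_size p / real CARD('n)"
proof -
  have card: "real (card s) = (\<Sum>j\<in>UNIV. indicator {s. j \<in> s} s)" for s :: "'n set"
    by (simp add: indicator_def)
  have "mean_batch_size p = (\<Sum>j\<in>UNIV. measure_pmf.prob p {s. j \<in> s})"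
    unfolding mean_batch_size_def card
    by (subst Bochner_Integration.integral_sum) (auto simp: integrable_measure_pmf_finite)
  also have "\<dots> = (\<Sum>j\<in>(UNIV :: 'n set). measure_pmf.prob p {s. i \<in> s})"
    using sampling unfolding uniform_sampling_def by (intro sum.cong) auto
  finally show ?thesis by simp
qed

lemma expectation_if_mem:
  "measure_pmf.expectation p (\<lambda>s. if i \<in> s then a else b) =
    b + mean_batch_size p / real CARD('n) * (a - b)" for a b :: real
proof -
  have "(\<lambda>s. if i \<in> s then a else b) = (\<lambda>s. b + (a - b) * indicator {s. i \<in> s} s)"
    by (auto simp: fun_eq_iff)
  then show ?thesis
    by (simp add: integrable_measure_pmf_finite prob_mem mult.commute)
qed

lemma rate_pos: "rate > 0"
  unfolding rate_def using vec_max_pos lam gamma batch_pos by (simp add: add_pos_pos)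

text \<open>A marginal is at most 1, so the mean batch size is at most the number of examples. Hence
  \<open>1 - 1 / rate\<close> is nonnegative, as iterating the contraction requires.\<close>

lemma rate_ge_1: "1 \<le> rate"
proof -
  have "mean_batch_size p \<le> real CARD('n)"
    using prob_mem[of undefined] measure_pmf.prob_le_1[of p "{s. undefined \<in> s}"]
    by (simp add: divide_le_eq)
  then have "mean_batch_size p * (lam * \<gamma>) \<le> real CARD('n) * (lam * \<gamma>)"
    using lam gamma by (intro mult_right_mono) auto
  moreover have "mean_batch_size p * lam * \<gamma> = mean_batch_size p * (lam * \<gamma>)"
    and "lam * real CARD('n) * \<gamma> = real CARD('n) * (lam * \<gamma>)" by simp_all
  ultimately have "mean_batch_size p * lam * \<gamma> \<le> vec_max v + lam * real CARD('n) * \<gamma>"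
    using vec_max_pos by linarith
  then show ?thesis
    unfolding rate_def using lam gamma batch_pos by simp
qed

text \<open>The conjugate terms have an exact expectation by the uniform marginals; only the squared
  norm is estimated, by ESO. The coordinate gains then add up to the gap.\<close>

lemma expected_dual_increase:
  assumes feas: "dual_feasible \<alpha>"
  shows "dual_value \<alpha> + gap \<alpha> / rate \<le> measure_pmf.expectation p (\<lambda>s. dual_value (step \<alpha> s))"
proof -
  define \<Delta> where "\<Delta> = sdca_increment lam X \<phi> v \<alpha>"
  define t :: "real^'n" where "t = (\<chi> i. \<Delta> i)"
  define q where "q = mean_batch_size p / real CARD('n)"
  define z where "z i = w \<alpha> \<bullet> row i X" for i
  define \<sigma> where "\<sigma> = lam * real CARD('n) * \<gamma> / (vec_max v + lam * real CARD('n) * \<gamma>)"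
  define c0 where "c0 i = loss_conj i (- (\<alpha> $ i))" for i
  define c1 where "c1 i = loss_conj i (- (\<alpha> $ i) - \<Delta> i)" for i
  have int [simp]: "integrable p f" for f :: "'n set \<Rightarrow> real"
    by (simp add: integrable_measure_pmf_finite)
  have step_eq: "step \<alpha> s = \<alpha> + restrict_vec t s" for s
    by (simp add: step_def restrict_vec_def t_def \<Delta>_def vec_eq_iff)
  have conj_step: "loss_conj i (- (step \<alpha> s $ i)) = (if i \<in> s then c1 i else c0 i)" for i s
    by (simp add: step_def \<Delta>_def c0_def c1_def)
  have E_conj: "measure_pmf.expectation p (\<lambda>s. \<Sum>i\<in>UNIV. loss_conj i (- (step \<alpha> s $ i)))
      = (\<Sum>i\<in>UNIV. c0 i + q * (c1 i - c0 i))"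
    unfolding conj_step by (subst Bochner_Integration.integral_sum) (simp_all add: expectation_if_mem q_def)
  have E_norm: "measure_pmf.expectation p (\<lambda>s. (norm (w (step \<alpha> s)))\<^sup>2)
      \<le> (norm (w \<alpha>))\<^sup>2 + q * ((\<Sum>i\<in>UNIV. v $ i * (\<Delta> i)\<^sup>2) / (lam * real CARD('n))\<^sup>2
        + 2 / (lam * real CARD('n)) * (\<Sum>i\<in>UNIV. \<Delta> i * z i))"
  proof -
    have "weighted_norm_sq v ((1 / (lam * real CARD('n))) *\<^sub>R t) = (\<Sum>i\<in>UNIV. v $ i * (\<Delta> i)\<^sup>2) / (lam * real CARD('n))\<^sup>2"
      by (simp add: weighted_norm_sq_def t_def power_divide sum_divide_distrib)
    moreover have "t \<bullet> (X *v w \<alpha>) = (\<Sum>i\<in>UNIV. \<Delta> i * z i)"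
      by (simp add: inner_vec_def vector_component_matrix t_def z_def)
    ultimately show ?thesis
      using eso[unfolded ESO_def, rule_format, of \<alpha> t]
      unfolding step_eq primal_of_dual_def q_def by simp
  qed
  \<comment> \<open>The probability of drawing a coordinate times the fraction of its residual that
    a draw gains.\<close>
  have "q * \<sigma> = 1 / rate"
    unfolding q_def \<sigma>_def rate_def by simp
  then have "gap \<alpha> / rate = q * \<sigma> * gap \<alpha>" by simp
  also have "\<dots> = q / real CARD('n) * (\<Sum>i\<in>UNIV. \<sigma> * (\<phi> i (z i) + c0 i + \<alpha> $ i * z i))"
    unfolding gap_eq_sum sum_distrib_left[symmetric] z_def[symmetric] c0_def[symmetric]
    by simp
  also have "\<dots> \<le> q / real CARD('n) * (\<Sum>i\<in>UNIV. c0 i - c1 i - v $ i * (\<Delta> i)\<^sup>2 / (2 * lam * real CARD('n)) - z i * \<Delta> i)"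
    using increment_gain[OF feas] batch_pos unfolding z_def c0_def c1_def \<Delta>_def \<sigma>_def q_def
    by (intro mult_left_mono sum_mono) auto
  \<comment> \<open>The penalties and linear terms are regrouped into \<open>lam / 2\<close> times
    the ESO bracket, so that \<open>E_norm\<close> applies.\<close>
  also have "\<dots> = q / real CARD('n) * (\<Sum>i\<in>UNIV. c0 i - c1 i)
      - lam / 2 * (q * ((\<Sum>i\<in>UNIV. v $ i * (\<Delta> i)\<^sup>2) / (lam * real CARD('n))\<^sup>2
        + 2 / (lam * real CARD('n)) * (\<Sum>i\<in>UNIV. \<Delta> i * z i)))"
  proof -
    have 1: "(\<Sum>i\<in>UNIV. c0 i - c1 i - v $ i * (\<Delta> i)\<^sup>2 / (2 * lam * real CARD('n)) - z i * \<Delta> i)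
      = (\<Sum>i\<in>UNIV. c0 i - c1 i) - (\<Sum>i\<in>UNIV. v $ i * (\<Delta> i)\<^sup>2) / (2 * lam * real CARD('n)) - (\<Sum>i\<in>UNIV. \<Delta> i * z i)"
      by (simp add: sum_subtractf sum_divide_distrib mult.commute)
    have 2: "q / real CARD('n) * (A - B / (2 * lam * real CARD('n)) - C)
      = q / real CARD('n) * A
        - lam / 2 * (q * (B / (lam * real CARD('n))\<^sup>2 + 2 / (lam * real CARD('n)) * C))" for A B C
      using lam by (simp add: field_simps power2_eq_square)
    show ?thesis unfolding 1 2 ..
  qed
  also have "\<dots> \<le> q / real CARD('n) * (\<Sum>i\<in>UNIV. c0 i - c1 i)
      - lam / 2 * (measure_pmf.expectation p (\<lambda>s. (norm (w (step \<alpha> s)))\<^sup>2) - (norm (w \<alpha>))\<^sup>2)"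
    using E_norm lam by (intro diff_left_mono mult_left_mono) auto
  also have "\<dots> = measure_pmf.expectation p (\<lambda>s. dual_value (step \<alpha> s)) - dual_value \<alpha>"
  proof -
    have "measure_pmf.expectation p (\<lambda>s. dual_value (step \<alpha> s))
      = - (1 / real CARD('n) * (\<Sum>i\<in>UNIV. c0 i + q * (c1 i - c0 i)))
        - lam / 2 * measure_pmf.expectation p (\<lambda>s. (norm (w (step \<alpha> s)))\<^sup>2)"
      unfolding dual_value_def E_conj[symmetric] by simp
    moreover have "dual_value \<alpha> = - (1 / real CARD('n) * (\<Sum>i\<in>UNIV. c0 i)) - lam / 2 * (norm (w \<alpha>))\<^sup>2"
      by (simp add: dual_value_def c0_def)
    ultimately show ?thesis
      by (simp add: sum.distrib sum_subtractf sum_distrib_left[symmetric] algebra_simps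
        add_divide_distrib diff_divide_distrib)
  qed
  finally show ?thesis by simp
qed

section \<open>Convexity of the gap\<close>

lemma conj_convex:
  assumes "conjugate (\<phi> i) a \<noteq> \<infinity>" "conjugate (\<phi> i) u \<noteq> \<infinity>" "0 \<le> s" "s \<le> 1"
  shows "conjugate (\<phi> i) ((1 - s) * a + s * u) \<noteq> \<infinity>"
    and "loss_conj i ((1 - s) * a + s * u) \<le> (1 - s) * loss_conj i a + s * loss_conj i u"
proof -
  have nonneg: "0 \<le> \<gamma> / 2 * s * (1 - s) * (u - a)\<^sup>2" using assms gamma by simp
  have strong: "conjugate (\<phi> i) ((1 - s) * a + s * u) \<le> ereal ((1 - s) * loss_conj i a + s * loss_conj i u
      - \<gamma> / 2 * s * (1 - s) * (u - a)\<^sup>2)"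
    using conjugate_strongly_convex[OF loss_smooth gamma] assms by (simp add: loss_conj_def)
  have le: "conjugate (\<phi> i) ((1 - s) * a + s * u) \<le> ereal ((1 - s) * loss_conj i a + s * loss_conj i u)"
    by (rule order_trans[OF strong]) (use nonneg in simp)
  show "conjugate (\<phi> i) ((1 - s) * a + s * u) \<noteq> \<infinity>"
    using conjugate_neq_PInf_if_le[OF le] .
  show "loss_conj i ((1 - s) * a + s * u) \<le> (1 - s) * loss_conj i a + s * loss_conj i u"
    using conjugate_le_realD[OF le] by (simp add: loss_conj_def)
qed

text \<open>Needed for averaged iterates. The domain is the feasible set, because elsewhere
  \<open>loss_conj\<close> may take the default value 0.\<close>

lemma convex_on_gap: "convex_on (Collect dual_feasible) gap"
proof (rule convex_onI)
  fix s :: real and \<alpha> \<beta> :: "real^'n"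
  assume s: "0 < s" "s < 1" and feas: "\<alpha> \<in> Collect dual_feasible" "\<beta> \<in> Collect dual_feasible"
  define \<zeta> where "\<zeta> = (1 - s) *\<^sub>R \<alpha> + s *\<^sub>R \<beta>"
  have w: "w \<zeta> = (1 - s) *\<^sub>R w \<alpha> + s *\<^sub>R w \<beta>"
    unfolding \<zeta>_def by (simp add: linear_add[OF primal_of_dual_linear] linear_scale[OF primal_of_dual_linear])
  have "\<phi> i (w \<zeta> \<bullet> row i X) \<le> (1 - s) * \<phi> i (w \<alpha> \<bullet> row i X) + s * \<phi> i (w \<beta> \<bullet> row i X)" for i
    using convex_onD[OF loss_convex, of s "w \<alpha> \<bullet> row i X" "w \<beta> \<bullet> row i X" i] s
    by (simp add: w inner_add_left)
  moreover have "loss_conj i (- (\<zeta> $ i)) \<le> (1 - s) * loss_conj i (- (\<alpha> $ i)) + s * loss_conj i (- (\<beta> $ i))" for i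
    using conj_convex(2)[of i "- (\<alpha> $ i)" "- (\<beta> $ i)" s] feas s
    by (simp add: \<zeta>_def dual_feasible_def algebra_simps)
  ultimately have "\<phi> i (w \<zeta> \<bullet> row i X) + loss_conj i (- (\<zeta> $ i))
      \<le> (1 - s) * (\<phi> i (w \<alpha> \<bullet> row i X) + loss_conj i (- (\<alpha> $ i)))
        + s * (\<phi> i (w \<beta> \<bullet> row i X) + loss_conj i (- (\<beta> $ i)))" for i
    unfolding distrib_left by (smt (verit))
  then have "(\<Sum>i\<in>UNIV. \<phi> i (w \<zeta> \<bullet> row i X) + loss_conj i (- (\<zeta> $ i)))
      \<le> (\<Sum>i\<in>UNIV. (1 - s) * (\<phi> i (w \<alpha> \<bullet> row i X) + loss_conj i (- (\<alpha> $ i)))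
        + s * (\<phi> i (w \<beta> \<bullet> row i X) + loss_conj i (- (\<beta> $ i))))"
    by (rule sum_mono)
  then have 1: "1 / real CARD('n) * (\<Sum>i\<in>UNIV. \<phi> i (w \<zeta> \<bullet> row i X) + loss_conj i (- (\<zeta> $ i)))
      \<le> 1 / real CARD('n) * ((1 - s) * (\<Sum>i\<in>UNIV. \<phi> i (w \<alpha> \<bullet> row i X) + loss_conj i (- (\<alpha> $ i)))
        + s * (\<Sum>i\<in>UNIV. \<phi> i (w \<beta> \<bullet> row i X) + loss_conj i (- (\<beta> $ i))))"
    unfolding sum.distrib[of "\<lambda>i. (1 - s) * _ i"] sum_distrib_left[symmetric]
    by (intro mult_left_mono) auto
  have "(norm (w \<zeta>))\<^sup>2 = (1 - s) * (norm (w \<alpha>))\<^sup>2 + s * (norm (w \<beta>))\<^sup>2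
      - s * (1 - s) * (norm (w \<alpha> - w \<beta>))\<^sup>2"
    unfolding w power2_norm_eq_inner by (simp add: inner_add inner_diff inner_commute algebra_simps)
  moreover have "0 \<le> s * (1 - s) * (norm (w \<alpha> - w \<beta>))\<^sup>2" using s by simp
  ultimately have "(norm (w \<zeta>))\<^sup>2 \<le> (1 - s) * (norm (w \<alpha>))\<^sup>2 + s * (norm (w \<beta>))\<^sup>2" by linarith
  then have 2: "lam * (norm (w \<zeta>))\<^sup>2 \<le> lam * ((1 - s) * (norm (w \<alpha>))\<^sup>2 + s * (norm (w \<beta>))\<^sup>2)"
    using lam by (intro mult_left_mono) auto
  have "(1 - s) * gap \<alpha> + s * gap \<beta>
      = 1 / real CARD('n) * ((1 - s) * (\<Sum>i\<in>UNIV. \<phi> i (w \<alpha> \<bullet> row i X) + loss_conj i (- (\<alpha> $ i)))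
        + s * (\<Sum>i\<in>UNIV. \<phi> i (w \<beta> \<bullet> row i X) + loss_conj i (- (\<beta> $ i))))
       + lam * ((1 - s) * (norm (w \<alpha>))\<^sup>2 + s * (norm (w \<beta>))\<^sup>2)"
    unfolding gap_eq_norm by (simp only: distrib_left mult.left_commute[of "1 / real CARD('n)"] mult.left_commute[of lam])
  then show "gap ((1 - s) *\<^sub>R \<alpha> + s *\<^sub>R \<beta>) \<le> (1 - s) * gap \<alpha> + s * gap \<beta>"
    using 1 2 unfolding \<zeta>_def[symmetric] gap_eq_norm[of \<zeta>] by linarith
next
  show "convex (Collect dual_feasible)"
    unfolding convex_alt
  proof (safe, goal_cases)
    case (1 \<alpha> \<beta> s)
    then have "conjugate (\<phi> i) ((1 - s) * - (\<alpha> $ i) + s * - (\<beta> $ i)) \<noteq> \<infinity>" for i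
      by (intro conj_convex(1)) (auto simp: dual_feasible_def)
    then show ?case by (simp add: dual_feasible_def)
  qed
qed

end

subsection \<open>The random iterates\<close>

lemma (in sdca_problem) sdca_Suc_step:
  "sdca lam X \<phi> v B (Suc t) = step (sdca lam X \<phi> v B t) (B t)"
  by (simp add: step_def Let_def)

lemma (in sdca_problem) dual_feasible_sdca: "dual_feasible (sdca lam X \<phi> v B t)"
proof (induction t)
  case 0
  then show ?case by (simp add: dual_feasible_zero)
next
  case (Suc t)
  then show ?case unfolding sdca_Suc_step by (rule dual_feasible_step)
qed

text \<open>Only the draws before time \<open>t\<close> enter the iterate at \<open>t\<close>; this
  is what makes it independent of draw \<open>t\<close>.\<close>

lemma sdca_cong:
  "(\<And>s. s < t \<Longrightarrow> B s = B' s) \<Longrightarrow> sdca lam X \<phi> v B t = sdca lam X \<phi> v B' t"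
  by (induction t) simp_all

text \<open>There are finitely many mini-batches, so an iterate takes finitely many values. All real
  functions of it are thus bounded, hence integrable.\<close>

lemma (in sdca_problem) finite_range_sdca: "finite (range (\<lambda>B. sdca lam X \<phi> v B t))"
proof (induction t)
  case (Suc t)
  have "range (\<lambda>B. sdca lam X \<phi> v B (Suc t))
    \<subseteq> (\<lambda>(\<alpha>, s). step \<alpha> s) ` (range (\<lambda>B. sdca lam X \<phi> v B t) \<times> UNIV)"
    unfolding sdca_Suc_step by auto
  then show ?case by (rule finite_subset) (use Suc in simp)
qed simp

text \<open>The discrete sigma-algebra on the target makes every function of an iterate measurable.
  Assuming measurability only of draws before \<open>t\<close> lets the lemma apply on the product
  space over \<open>{..<t}\<close>.\<close>

lemma (in sdca_problem) measurable_sdca: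
  assumes "\<And>s. s < t \<Longrightarrow> (\<lambda>\<omega>. B \<omega> s) \<in> measurable M (count_space UNIV)"
  shows "(\<lambda>\<omega>. sdca lam X \<phi> v (B \<omega>) t) \<in> measurable M (count_space UNIV)"
  using assms
proof (induction t)
  case (Suc t)
  have "(\<lambda>\<omega>. sdca lam X \<phi> v (B \<omega>) t) \<in> measurable M (count_space UNIV)"
    using Suc by simp
  then have "(\<lambda>\<omega>. step (sdca lam X \<phi> v (B \<omega>) t) s) \<in> measurable M (count_space UNIV)" for s
    by (rule measurable_compose) simp
  then show ?case
    unfolding sdca_Suc_step
    by (rule measurable_compose_countable[where g = "\<lambda>\<omega>. B \<omega> t"]) (use Suc.prems in simp)
qed simp

locale sdca_process = sdca_problem X lam \<gamma> \<phi> v p + prob_space M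
  for X :: "real^'d^'n" and lam \<gamma> :: real and \<phi> :: "'n \<Rightarrow> real \<Rightarrow> real"
    and v :: "real^'n" and p :: "'n set pmf" and M :: "'w measure" +
  fixes S :: "nat \<Rightarrow> 'w \<Rightarrow> 'n set"
  assumes draws_indep: "indep_vars (\<lambda>_. count_space UNIV) S UNIV"
    and draws_distr: "\<And>t. distr M (count_space UNIV) (S t) = measure_pmf p"
begin

definition iterate :: "nat \<Rightarrow> 'w \<Rightarrow> real^'n" where
  "iterate t \<omega> = sdca lam X \<phi> v (\<lambda>s. S s \<omega>) t"

lemma iterate_0 [simp]: "iterate 0 \<omega> = 0"
  by (simp add: iterate_def)

lemma iterate_Suc: "iterate (Suc t) \<omega> = step (iterate t \<omega>) (S t \<omega>)"
  unfolding iterate_def by (rule sdca_Suc_step)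

lemma feasible_iterate: "dual_feasible (iterate t \<omega>)"
  unfolding iterate_def by (rule dual_feasible_sdca)

lemma measurable_draw [measurable]: "S t \<in> measurable M (count_space UNIV)"
  using draws_indep by (auto simp: indep_vars_def)

lemma measurable_iterate [measurable]: "iterate t \<in> measurable M (count_space UNIV)"
  unfolding iterate_def by (rule measurable_sdca) simp

lemma integrable_iterate [simp]: "integrable M (\<lambda>\<omega>. f (iterate t \<omega>))" for f :: "real^'n \<Rightarrow> real"
proof -
  let ?R = "(\<lambda>\<alpha>. \<bar>f \<alpha>\<bar>) ` range (\<lambda>B. sdca lam X \<phi> v B t)"
  have "norm (f (iterate t \<omega>)) \<le> Max ?R" for \<omega>
    unfolding iterate_def by (rule Max_ge) (auto simp: finite_range_sdca)
  moreover have "(\<lambda>\<omega>. f (iterate t \<omega>)) \<in> borel_measurable M"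
    by (rule measurable_compose[OF measurable_iterate]) simp
  ultimately show ?thesis by (intro integrable_const_bound[of _ "Max ?R"]) auto
qed

text \<open>Functions of disjoint blocks of independent draws, here \<open>{..<t}\<close> and
  \<open>{t}\<close>, are independent.\<close>

lemma indep_iterate_draw:
  fixes f :: "real^'n \<Rightarrow> real" and h :: "'n set \<Rightarrow> real"
  shows "indep_var borel (\<lambda>\<omega>. f (iterate t \<omega>)) borel (\<lambda>\<omega>. h (S t \<omega>))"
proof -
  let ?C = "\<lambda>_ :: nat. count_space (UNIV :: 'n set set)"
  have "indep_var (PiM {..<t} ?C) (\<lambda>\<omega>. restrict (\<lambda>i. S i \<omega>) {..<t})
      (PiM {t} ?C) (\<lambda>\<omega>. restrict (\<lambda>i. S i \<omega>) {t})"
    by (rule indep_var_restrict[OF draws_indep]) auto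
  moreover have "(\<lambda>B. sdca lam X \<phi> v B t) \<in> measurable (PiM {..<t} ?C) (count_space UNIV)"
    by (rule measurable_sdca) (auto intro: measurable_component_singleton)
  then have "(\<lambda>B. f (sdca lam X \<phi> v B t)) \<in> measurable (PiM {..<t} ?C) borel"
    by (rule measurable_compose) simp
  moreover have "(\<lambda>B. h (B t)) \<in> measurable (PiM {t} ?C) borel"
    by (rule measurable_compose[OF measurable_component_singleton[of t]]) simp_all
  ultimately have "indep_var borel
      ((\<lambda>B. f (sdca lam X \<phi> v B t)) \<circ> (\<lambda>\<omega>. restrict (\<lambda>i. S i \<omega>) {..<t}))
      borel ((\<lambda>B. h (B t)) \<circ> (\<lambda>\<omega>. restrict (\<lambda>i. S i \<omega>) {t}))"
    by (rule indep_var_compose)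
  \<comment> \<open>Outside \<open>{..<t}\<close> the restricted sequence is
    \<open>undefined\<close>, which the iterate at \<open>t\<close> never reads.\<close>
  moreover have "sdca lam X \<phi> v (restrict (\<lambda>i. S i \<omega>) {..<t}) t = iterate t \<omega>" for \<omega>
    unfolding iterate_def by (rule sdca_cong) simp
  ultimately show ?thesis by (simp add: comp_def)
qed

lemma prob_draw: "expectation (\<lambda>\<omega>. indicator {s} (S t \<omega>)) = pmf p s"
proof -
  have "expectation (\<lambda>\<omega>. indicator {s} (S t \<omega>)) =
      (\<integral>s'. (indicator {s} s' :: real) \<partial>distr M (count_space UNIV) (S t))"
    by (rule integral_distr[symmetric]) auto
  also have "\<dots> = pmf p s"
    unfolding draws_distr by (simp add: pmf.rep_eq)
  finally show ?thesis .
qed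

text \<open>The tower property, by summing over the finitely many values of draw \<open>t\<close>
  and factoring each term by independence.\<close>

lemma expectation_iterate_Suc:
  fixes f :: "real^'n \<Rightarrow> real"
  shows "expectation (\<lambda>\<omega>. f (iterate (Suc t) \<omega>)) =
    expectation (\<lambda>\<omega>. measure_pmf.expectation p (\<lambda>s. f (step (iterate t \<omega>) s)))"
proof -
  have int: "integrable M (\<lambda>\<omega>. indicator {s} (S t \<omega>) :: real)" for s
    by (intro integrable_const_bound[of _ 1]) auto
  have indep: "indep_var borel (\<lambda>\<omega>. f (step (iterate t \<omega>) s)) borel (\<lambda>\<omega>. indicator {s} (S t \<omega>) :: real)" for s
    by (rule indep_iterate_draw)
  have "f (iterate (Suc t) \<omega>) = (\<Sum>s\<in>UNIV. f (step (iterate t \<omega>) s) * indicator {s} (S t \<omega>))" for \<omega>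
    by (simp add: iterate_Suc indicator_def)
  then have "expectation (\<lambda>\<omega>. f (iterate (Suc t) \<omega>))
      = expectation (\<lambda>\<omega>. \<Sum>s\<in>UNIV. f (step (iterate t \<omega>) s) * indicator {s} (S t \<omega>))"
    by simp
  also have "\<dots> = (\<Sum>s\<in>UNIV. expectation (\<lambda>\<omega>. f (step (iterate t \<omega>) s) * indicator {s} (S t \<omega>)))"
    by (intro Bochner_Integration.integral_sum indep_var_integrable[OF indep] int
      integrable_iterate[of "\<lambda>\<alpha>. f (step \<alpha> _)"])
  also have "\<dots> = (\<Sum>s\<in>UNIV. expectation (\<lambda>\<omega>. f (step (iterate t \<omega>) s)) * pmf p s)"
    by (simp only: indep_var_lebesgue_integral[OF indep integrable_iterate[of "\<lambda>\<alpha>. f (step \<alpha> _)"] int]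
      prob_draw)
  also have "\<dots> = (\<Sum>s\<in>UNIV. expectation (\<lambda>\<omega>. f (step (iterate t \<omega>) s) * pmf p s))"
    by simp
  also have "\<dots> = expectation (\<lambda>\<omega>. \<Sum>s\<in>UNIV. f (step (iterate t \<omega>) s) * pmf p s)"
    by (rule Bochner_Integration.integral_sum[symmetric])
      (rule integrable_iterate[of "\<lambda>\<alpha>. f (step \<alpha> _) * _"])
  also have "\<dots> = expectation (\<lambda>\<omega>. measure_pmf.expectation p (\<lambda>s. f (step (iterate t \<omega>) s)))"
    by (subst integral_measure_pmf_real[of UNIV]) auto
  finally show ?thesis .
qed

section \<open>Convergence in expectation\<close>

definition mean_dual :: "nat \<Rightarrow> real" where
  "mean_dual t = expectation (\<lambda>\<omega>. dual_value (iterate t \<omega>))"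

definition mean_gap :: "nat \<Rightarrow> real" where
  "mean_gap t = expectation (\<lambda>\<omega>. gap (iterate t \<omega>))"

text \<open>The primal infimum serves as reference value: it lies above all feasible dual values by
  weak duality and below all primal values, so the gap dominates the dual suboptimality.\<close>

definition opt :: real where
  "opt = (INF u. prim u)"

lemma opt_le: "opt \<le> prim u"
  unfolding opt_def using primal_nonneg by (intro cINF_lower bdd_belowI[of _ 0]) auto

lemma mean_gap_le: "mean_gap t \<le> rate * (mean_dual (Suc t) - mean_dual t)"
proof -
  have "mean_dual t + mean_gap t / rate = expectation (\<lambda>\<omega>. dual_value (iterate t \<omega>) + gap (iterate t \<omega>) / rate)"
    unfolding mean_dual_def mean_gap_def by simp
  also have "\<dots> \<le> expectation (\<lambda>\<omega>. measure_pmf.expectation p (\<lambda>s. dual_value (step (iterate t \<omega>) s)))"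
    using expected_dual_increase[OF feasible_iterate]
    by (intro integral_mono integrable_iterate[of "\<lambda>\<alpha>. measure_pmf.expectation p (\<lambda>s. dual_value (step \<alpha> s))"]
      integrable_iterate[of "\<lambda>\<alpha>. dual_value \<alpha> + gap \<alpha> / rate"])
  also have "\<dots> = mean_dual (Suc t)"
    unfolding mean_dual_def by (rule expectation_iterate_Suc[symmetric])
  finally show ?thesis using rate_pos by (simp add: field_simps)
qed

lemma mean_dual_le_opt: "mean_dual t \<le> opt"
proof -
  have "dual_value (iterate t \<omega>) \<le> opt" for \<omega>
    unfolding opt_def using weak_duality[OF feasible_iterate] by (intro cINF_greatest) auto
  then have "mean_dual t \<le> expectation (\<lambda>\<omega>. opt)"
    unfolding mean_dual_def by (intro integral_mono) auto
  then show ?thesis by (simp add: prob_space)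
qed

lemma opt_minus_mean_dual_le: "opt - mean_dual t \<le> mean_gap t"
proof -
  have "expectation (\<lambda>\<omega>. opt - dual_value (iterate t \<omega>)) \<le> mean_gap t"
    unfolding mean_gap_def
    using opt_le by (intro integral_mono integrable_iterate[of "\<lambda>\<alpha>. opt - dual_value \<alpha>"] integrable_iterate)
      (simp add: gap_def)
  then show ?thesis unfolding mean_dual_def by (simp add: prob_space)
qed

text \<open>Chaining \<open>opt_minus_mean_dual_le\<close> with \<open>mean_gap_le\<close> bounds
  the suboptimality by \<open>rate\<close> times its own decrease, which is a contraction.\<close>

lemma suboptimality_power: "opt - mean_dual t \<le> (1 - 1 / rate) ^ t"
proof (induction t)
  case 0
  have "opt \<le> 1" using opt_le[of 0] primal_zero_le by linarith
  moreover have "mean_dual 0 = dual_value 0" by (simp add: mean_dual_def prob_space)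
  ultimately show ?case using dual_value_zero by simp
next
  case (Suc t)
  have "opt - mean_dual t \<le> rate * (mean_dual (Suc t) - mean_dual t)"
    using opt_minus_mean_dual_le mean_gap_le by (rule order_trans)
  then have "(opt - mean_dual t) / rate \<le> mean_dual (Suc t) - mean_dual t"
    using rate_pos by (simp add: divide_le_eq mult.commute)
  then have "opt - mean_dual (Suc t) \<le> (1 - 1 / rate) * (opt - mean_dual t)"
    by (simp add: left_diff_distrib)
  also have "\<dots> \<le> (1 - 1 / rate) * (1 - 1 / rate) ^ t"
    using Suc rate_ge_1 by (intro mult_left_mono) auto
  finally show ?case by simp
qed

lemma suboptimality_exp: "opt - mean_dual t \<le> exp (- real t / rate)"
proof -
  have "(1 - 1 / rate) ^ t \<le> exp (- 1 / rate) ^ t"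
    using rate_ge_1 exp_ge_add_one_self[of "- 1 / rate"] by (intro power_mono) auto
  also have "\<dots> = exp (- real t / rate)"
    by (simp add: exp_of_nat_mult[symmetric])
  finally show ?thesis using suboptimality_power[of t] by linarith
qed

lemma sum_mean_gap_le:
  assumes "T0 \<le> T"
  shows "(\<Sum>t = T0..<T. mean_gap t) \<le> rate * exp (- real T0 / rate)"
proof -
  have "(\<Sum>t = T0..<T. mean_gap t) \<le> (\<Sum>t = T0..<T. rate * (mean_dual (Suc t) - mean_dual t))"
    by (intro sum_mono mean_gap_le)
  also have "\<dots> = rate * (mean_dual T - mean_dual T0)"
    unfolding sum_distrib_left[symmetric] using assms by (simp add: sum_Suc_diff')
  \<comment> \<open>The telescoped sum ends at a mean dual value of at most \<open>opt\<close>, so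
    the suboptimality at \<open>T0\<close> bounds the whole window.\<close>
  also have "\<dots> \<le> rate * exp (- real T0 / rate)"
    using mean_dual_le_opt[of T] suboptimality_exp[of T0] rate_pos by (intro mult_left_mono) auto
  finally show ?thesis .
qed

text \<open>Exponentiating the logarithmic threshold on the number of steps gives the
  accuracy.\<close>

lemma exp_rate_le:
  assumes "\<epsilon> > 0" and "rate * ln (rate * (1 / \<epsilon>)) \<le> real T"
  shows "rate * exp (- real T / rate) \<le> \<epsilon>"
proof -
  have "ln (rate / \<epsilon>) \<le> real T / rate"
    using assms rate_pos by (simp add: le_divide_eq mult.commute)
  then have "rate / \<epsilon> \<le> exp (real T / rate)"
    using assms(1) rate_pos by (metis divide_pos_pos exp_le_cancel_iff exp_ln)
  then show ?thesis
    using assms(1) by (simp add: exp_minus field_simps)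
qed

lemma mean_gap_le_exp: "mean_gap T \<le> rate * exp (- real T / rate)"
  using sum_mean_gap_le[of T "Suc T"] by simp

text \<open>Jensen's inequality with uniform weights, which sum to 1 because the window is
  nonempty.\<close>

lemma gap_average_le:
  assumes "T0 < T"
  defines "\<beta> \<equiv> \<lambda>\<omega>. sdca_average lam X \<phi> v (\<lambda>s. S s \<omega>) T0 T"
  shows "dual_feasible (\<beta> \<omega>)"
    and "gap (\<beta> \<omega>) \<le> (\<Sum>t = T0..<T. gap (iterate t \<omega>)) / real (T - T0)"
proof -
  have avg: "\<beta> \<omega> = (\<Sum>t = T0..<T. (1 / real (T - T0)) *\<^sub>R iterate t \<omega>)"
    by (simp add: \<beta>_def sdca_average_def iterate_def scaleR_sum_right)
  have weights: "(\<Sum>t = T0..<T. 1 / real (T - T0)) = 1" using assms(1) by simp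
  have "\<beta> \<omega> \<in> Collect dual_feasible"
    unfolding avg
    by (rule convex_sum[OF _ convex_on_imp_convex[OF convex_on_gap] weights])
      (simp_all add: feasible_iterate)
  then show "dual_feasible (\<beta> \<omega>)" by simp
  have "gap (\<beta> \<omega>) \<le> (\<Sum>t = T0..<T. 1 / real (T - T0) * gap (iterate t \<omega>))"
    unfolding avg
    by (rule convex_on_sum[OF _ _ convex_on_gap weights]) (use assms(1) in \<open>simp_all add: feasible_iterate\<close>)
  then show "gap (\<beta> \<omega>) \<le> (\<Sum>t = T0..<T. gap (iterate t \<omega>)) / real (T - T0)"
    by (simp add: sum_divide_distrib)
qed

end

text \<open>The positive part of \<open>f\<close> integrates to at most the integral of
  \<open>g\<close>, and subtracting the negative part can only lower the value.\<close>

lemma ereal_expectation_le: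
  fixes g :: "'w \<Rightarrow> real"
  assumes le: "\<And>\<omega>. f \<omega> \<le> ereal (g \<omega>)" and g: "integrable M g" "\<And>\<omega>. 0 \<le> g \<omega>"
    and int: "integral\<^sup>L M g \<le> c"
  shows "ereal_expectation M f \<le> ereal c"
proof -
  have "e2ennreal (f \<omega>) \<le> ennreal (g \<omega>)" for \<omega>
    using e2ennreal_mono[OF le[of \<omega>]] by (simp add: e2ennreal_ereal)
  then have "(\<integral>\<^sup>+ \<omega>. e2ennreal (f \<omega>) \<partial>M) \<le> (\<integral>\<^sup>+ \<omega>. ennreal (g \<omega>) \<partial>M)"
    by (intro nn_integral_mono)
  also have "\<dots> = ennreal (integral\<^sup>L M g)"
    using g by (intro nn_integral_eq_integral) auto
  also have "\<dots> \<le> ennreal c" using int by (rule ennreal_leI)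
  finally have "enn2ereal (\<integral>\<^sup>+ \<omega>. e2ennreal (f \<omega>) \<partial>M) \<le> enn2ereal (ennreal c)"
    by (simp add: less_eq_ennreal.rep_eq)
  also have "\<dots> = ereal c"
  proof (rule enn2ereal_ennreal)
    have "0 \<le> integral\<^sup>L M g" by (rule integral_nonneg_AE) (simp add: g(2))
    then show "0 \<le> c" using int by simp
  qed
  finally have "enn2ereal (\<integral>\<^sup>+ \<omega>. e2ennreal (f \<omega>) \<partial>M) \<le> ereal c" .
  moreover have "0 \<le> enn2ereal (\<integral>\<^sup>+ \<omega>. e2ennreal (- f \<omega>) \<partial>M)" by simp
  ultimately show ?thesis
    unfolding ereal_expectation_def by (metis diff_zero ereal_diff_le_mono_left ereal_minus_mono)
qed

theorem theorem2:
  fixes X :: "real^'d^'n"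
    and lam \<gamma> \<epsilon> :: real
    and \<phi> :: "'n \<Rightarrow> real \<Rightarrow> real"
    and v :: "real^'n"
    and p :: "'n set pmf"
    and M :: "'w measure"
    and S :: "nat \<Rightarrow> 'w \<Rightarrow> 'n set"
  defines "b \<equiv> mean_batch_size p"
    and "n \<equiv> real CARD('n)"
    and "vmax \<equiv> vec_max v"
    and "\<alpha> \<equiv> (\<lambda>t \<omega>. sdca lam X \<phi> v (\<lambda>s. S s \<omega>) t)"
    and "\<alpha>_avg \<equiv> (\<lambda>T0 T \<omega>. sdca_average lam X \<phi> v (\<lambda>s. S s \<omega>) T0 T)"
  assumes lam: "lam > 0"
    and loss_convex: "\<And>i. convex_on UNIV (\<phi> i)"
    and loss_nonneg: "\<And>i z. \<phi> i z \<ge> 0"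
    and loss_zero: "\<And>i. \<phi> i 0 \<le> 1"
    and gamma: "\<gamma> > 0"
    and loss_smooth: "\<And>i. smooth_loss (1 / \<gamma>) (\<phi> i)"
    and sampling: "uniform_sampling p"
    and batch_pos: "b > 0"
    and v_pos: "\<And>i. v $ i > 0"
    and eso: "ESO lam X p v"
    and prob: "prob_space M"
    and draws_indep: "prob_space.indep_vars M (\<lambda>_. count_space UNIV) S UNIV"
    and draws_distr: "\<And>t. distr M (count_space UNIV) (S t) = measure_pmf p"
    and eps: "\<epsilon> > 0"
  shows
    "(\<forall>T::nat.
        real T \<ge> vmax / b * (1 / (lam * \<gamma>) + n / vmax)
                  * ln (vmax / b * (1 / (lam * \<gamma>) + n / vmax) * (1 / \<epsilon>))
        \<longrightarrow> ereal_expectation M (\<lambda>\<omega>. duality_gap lam X \<phi> (\<alpha> T \<omega>)) \<le> ereal \<epsilon>)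
     \<and> (\<forall>T T0 :: nat.
        T > T0 \<and>
        real T0 \<ge> vmax / b * (1 / (lam * \<gamma>) + n / vmax)
                   * ln (vmax / b * (1 / (lam * \<gamma>) + n / vmax) * (1 / ((real T - real T0) * \<epsilon>)))
        \<longrightarrow> ereal_expectation M (\<lambda>\<omega>. duality_gap lam X \<phi> (\<alpha>_avg T0 T \<omega>)) \<le> ereal \<epsilon>)
     \<and> (\<forall>(\<rho>::real) (T::nat).
        0 < \<rho> \<and> \<rho> < 1 \<and>
        real T \<ge> (vmax + lam * n * \<gamma>) / (b * lam * \<gamma>)
                  * ln ((vmax + lam * n * \<gamma>) / (b * lam * \<gamma>) * (1 / (\<epsilon> * \<rho>)))
        \<longrightarrow> measure M {\<omega> \<in> space M. duality_gap lam X \<phi> (\<alpha> T \<omega>) \<le> ereal \<epsilon>} \<ge> 1 - \<rho>)"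
proof -
  interpret prob_space M by (rule prob)
  interpret sdca_process X lam \<gamma> \<phi> v p M S
    using assms(6-) unfolding b_def
    by (intro sdca_process.intro sdca_problem.intro sdca_process_axioms.intro) auto
  have \<alpha>: "\<alpha> t \<omega> = iterate t \<omega>" for t \<omega> by (simp add: \<alpha>_def iterate_def)
  have rate: "(vmax + lam * n * \<gamma>) / (b * lam * \<gamma>) = rate"
    by (simp add: rate_def vmax_def n_def b_def)
  have "vmax > 0" "b > 0" using vec_max_pos batch_pos by (simp_all add: vmax_def b_def)
  \<comment> \<open>The prefactors of the three thresholds are the same constant.\<close>
  then have rate': "vmax / b * (1 / (lam * \<gamma>) + n / vmax) = rate"
    unfolding rate[symmetric]
    using lam gamma by (simp add: field_simps)
  have gap_T: "duality_gap lam X \<phi> (\<alpha> T \<omega>) = ereal (gap (iterate T \<omega>))" for T \<omega>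
    unfolding \<alpha> by (rule duality_gap_eq[OF feasible_iterate])
  have mean_gap_le_eps: "mean_gap T \<le> c" if "c > 0" "rate * ln (rate * (1 / c)) \<le> real T" for T c
    using mean_gap_le_exp exp_rate_le[OF that] by (rule order_trans)
  have "ereal_expectation M (\<lambda>\<omega>. duality_gap lam X \<phi> (\<alpha> T \<omega>)) \<le> ereal \<epsilon>"
    if "rate * ln (rate * (1 / \<epsilon>)) \<le> real T" for T
    using mean_gap_le_eps[OF eps that]
    by (intro ereal_expectation_le[of _ "\<lambda>\<omega>. gap (iterate T \<omega>)"])
      (auto simp: gap_T gap_nonneg[OF feasible_iterate] mean_gap_def)
  moreover have "ereal_expectation M (\<lambda>\<omega>. duality_gap lam X \<phi> (\<alpha>_avg T0 T \<omega>)) \<le> ereal \<epsilon>"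
    if "T0 < T" "rate * ln (rate * (1 / ((real T - real T0) * \<epsilon>))) \<le> real T0" for T T0
  proof (rule ereal_expectation_le)
    let ?g = "\<lambda>\<omega>. (\<Sum>t = T0..<T. gap (iterate t \<omega>)) / real (T - T0)"
    show "duality_gap lam X \<phi> (\<alpha>_avg T0 T \<omega>) \<le> ereal (?g \<omega>)" for \<omega>
      using gap_average_le[OF that(1), of \<omega>] by (simp add: \<alpha>_avg_def duality_gap_eq)
    show "integrable M ?g" by simp
    show "0 \<le> ?g \<omega>" for \<omega>
      by (intro divide_nonneg_nonneg sum_nonneg gap_nonneg feasible_iterate) simp
    have "expectation ?g = (\<Sum>t = T0..<T. mean_gap t) / real (T - T0)"
      by (simp add: mean_gap_def)
    \<comment> \<open>The threshold is used with accuracy \<open>(T - T0) * \<epsilon>\<close> for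
      the sum of the gaps, so averaging leaves \<open>\<epsilon>\<close>.\<close>
    also have "\<dots> \<le> (real T - real T0) * \<epsilon> / real (T - T0)"
      using sum_mean_gap_le[of T0 T] exp_rate_le[OF _ that(2)] that(1) eps
      by (intro divide_right_mono) auto
    also have "\<dots> = \<epsilon>" using that(1) by (simp add: of_nat_diff)
    finally show "expectation ?g \<le> \<epsilon>" .
  qed
  moreover have "measure M {\<omega> \<in> space M. duality_gap lam X \<phi> (\<alpha> T \<omega>) \<le> ereal \<epsilon>} \<ge> 1 - \<rho>"
    if "0 < \<rho>" "rate * ln (rate * (1 / (\<epsilon> * \<rho>))) \<le> real T" for \<rho> T
  proof -
    have [measurable]: "(\<lambda>\<omega>. gap (iterate T \<omega>)) \<in> borel_measurable M"
      by (rule borel_measurable_integrable) simp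
    have "prob {\<omega> \<in> space M. \<epsilon> < gap (iterate T \<omega>)} \<le> prob {\<omega> \<in> space M. \<epsilon> \<le> gap (iterate T \<omega>)}"
      by (intro finite_measure_mono) auto
    also have "\<dots> \<le> mean_gap T / \<epsilon>"
      unfolding mean_gap_def using eps gap_nonneg[OF feasible_iterate]
      by (intro integral_Markov_inequality_measure[of _ _ "{}"]) auto
    \<comment> \<open>The mean gap is at most \<open>\<epsilon> * \<rho>\<close>, so the Markov
      quotient is at most \<open>\<rho>\<close>.\<close>
    also have "\<dots> \<le> \<rho>"
      using mean_gap_le_eps[of "\<epsilon> * \<rho>" T] that eps by (simp add: divide_le_eq mult.commute)
    finally have "prob {\<omega> \<in> space M. \<epsilon> < gap (iterate T \<omega>)} \<le> \<rho>" .
    moreover have "prob {\<omega> \<in> space M. \<not> gap (iterate T \<omega>) \<le> \<epsilon>} = 1 - prob {\<omega> \<in> space M. gap (iterate T \<omega>) \<le> \<epsilon>}"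
      by (rule prob_neg) measurable
    ultimately show ?thesis by (simp add: gap_T not_le)
  qed
  ultimately show ?thesis unfolding rate rate' by blast
qed

end
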